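(* (1) Let the numbers $E_n(k)$ ($n\ge1$, $1\le k\le n$) be defined by $E_1(1)=1$, $E_n(n)=0$ for $n\ge2$, and $E_n(m+1)-E_n(m)+E_{n-1}(n-m)=0$ for $n\ge2$, $m=n-1,\dots,2,1$. Then for every $n\ge1$, $\sum_{k=1}^{2n-1}E_{2n-1}(k)=E_{2n-1}$ and $\sum_{k=1}^{2n}E_{2n}(k)=E_{2n}$. (2) Let $(A_n,B_n)_{n\ge2}$ be the twin Seidel matrix sequence, with entries $a_n(m,k)$, $b_n(m,k)$. Then for every $n\ge2$: $a_n(m,\bullet)=E_n(m)$ and $b_n(m,\bullet)=E_n(n+1-m)$ for $1\le m\le n$, and $a_n(\bullet,k)=b_n(\bullet,k)=E_n(n-k)$ for $1\le k\le n$, with the convention $E_n(0)=0$.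
   Context: $E_n$ are the tangent/secant numbers: $\sum_{n\ge0}E_nu^n/n!=\tan u+\sec u$. Row and column sums: $a_n(m,\bullet)=\sum_k a_n(m,k)$, $a_n(\bullet,k)=\sum_m a_n(m,k)$, similarly for $b$. Twin Seidel matrix sequence: the unique sequence of square matrices $A_n=(a_n(m,k))_{1\le m,k\le n}$, $B_n=(b_n(m,k))_{1\le m,k\le n}$ ($n\ge2$) with nonnegative integer entries satisfying: (TS1) all diagonal entries are $0$, except $a_2(1,1)=1$; (TS2) for $n\ge3$: $a_n(m,n)=b_n(m,n)=0$ for all $m$, $a_n(n,k)=b_n(1,k)=0$ for all $k$, and $b_n(n,1)=0$; (TS3) $A_2=\begin{pmatrix}1&0\\0&0\end{pmatrix}$, $B_2=\begin{pmatrix}0&0\\1&0\end{pmatrix}$; (TS4) for $n\ge3$: $b_n(n,k)=a_{n-1}(\bullet,k-1)$ for $2\le k\le n-1$; $b_n(n-1,k)=a_{n-1}(\bullet,k)$ for $1\le k\le n-2$; $b_n(m+1,k)-b_n(m,k)=a_{n-1}(m,k)$ for $2\le k+1\le m\le n-2$; $b_n(m+1,k)-b_n(m,k)=a_{n-1}(m,k-1)$ for $3\le m+2\le k\le n-1$; (TS5) for $n\ge3$: $a_n(1,k)=b_{n-1}(\bullet,k-1)$ for $2\le k\le n-1$; $a_n(m+1,k)-a_n(m,k)=-b_{n-1}(m,k-1)$ for $3\le m+2\le k\le n-1$; $a_n(m+1,k)-a_n(m,k)=-b_{n-1}(m,k)$ for $2\le k+1\le m\le n-1$. *)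

theory Defs
  imports "HOL-Computational_Algebra.Formal_Power_Series"
begin

definition tan_sec_number :: "nat \<Rightarrow> real" where
  "tan_sec_number n = fact n * fps_nth (fps_tan 1 + inverse (fps_cos 1)) n"

text \<open>A triangular array is a function \<open>e n k\<close> of which only the values with
  \<open>1 \<le> k \<le> n\<close> matter; likewise a sequence of \<open>n \<times> n\<close> matrices is a function \<open>a n m k\<close> of which
  only the values with \<open>n \<ge> 2\<close> and \<open>1 \<le> m, k \<le> n\<close> matter.\<close>

definition entringer_array :: "(nat \<Rightarrow> nat \<Rightarrow> int) \<Rightarrow> bool" where
  "entringer_array e \<longleftrightarrow>
     e 1 1 = 1 \<and>
     (\<forall>n\<ge>2. e n n = 0) \<and>
     (\<forall>n\<ge>2. \<forall>m\<in>{1..n-1}. e n (m + 1) - e n m + e (n - 1) (n - m) = 0)"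

definition row_sum :: "(nat \<Rightarrow> nat \<Rightarrow> nat \<Rightarrow> int) \<Rightarrow> nat \<Rightarrow> nat \<Rightarrow> int" where
  "row_sum a n m = (\<Sum>k=1..n. a n m k)"

definition col_sum :: "(nat \<Rightarrow> nat \<Rightarrow> nat \<Rightarrow> int) \<Rightarrow> nat \<Rightarrow> nat \<Rightarrow> int" where
  "col_sum a n k = (\<Sum>m=1..n. a n m k)"

definition nonneg_entries :: "(nat \<Rightarrow> nat \<Rightarrow> nat \<Rightarrow> int) \<Rightarrow> bool" where
  "nonneg_entries a \<longleftrightarrow> (\<forall>n\<ge>2. \<forall>m\<in>{1..n}. \<forall>k\<in>{1..n}. a n m k \<ge> 0)"

definition TS1 :: "(nat \<Rightarrow> nat \<Rightarrow> nat \<Rightarrow> int) \<Rightarrow> (nat \<Rightarrow> nat \<Rightarrow> nat \<Rightarrow> int) \<Rightarrow> bool" where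
  "TS1 a b \<longleftrightarrow>
     (\<forall>n\<ge>2. \<forall>m\<in>{1..n}. a n m m = (if n = 2 \<and> m = 1 then 1 else 0) \<and> b n m m = 0)"

definition TS2 :: "(nat \<Rightarrow> nat \<Rightarrow> nat \<Rightarrow> int) \<Rightarrow> (nat \<Rightarrow> nat \<Rightarrow> nat \<Rightarrow> int) \<Rightarrow> bool" where
  "TS2 a b \<longleftrightarrow> (\<forall>n\<ge>3.
     (\<forall>m\<in>{1..n}. a n m n = 0 \<and> b n m n = 0) \<and>
     (\<forall>k\<in>{1..n}. a n n k = 0 \<and> b n 1 k = 0) \<and>
     b n n 1 = 0)"

definition TS3 :: "(nat \<Rightarrow> nat \<Rightarrow> nat \<Rightarrow> int) \<Rightarrow> (nat \<Rightarrow> nat \<Rightarrow> nat \<Rightarrow> int) \<Rightarrow> bool" where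
  "TS3 a b \<longleftrightarrow>
     a 2 1 1 = 1 \<and> a 2 1 2 = 0 \<and> a 2 2 1 = 0 \<and> a 2 2 2 = 0 \<and>
     b 2 1 1 = 0 \<and> b 2 1 2 = 0 \<and> b 2 2 1 = 1 \<and> b 2 2 2 = 0"

definition TS4 :: "(nat \<Rightarrow> nat \<Rightarrow> nat \<Rightarrow> int) \<Rightarrow> (nat \<Rightarrow> nat \<Rightarrow> nat \<Rightarrow> int) \<Rightarrow> bool" where
  "TS4 a b \<longleftrightarrow> (\<forall>n\<ge>3.
     (\<forall>k. 2 \<le> k \<and> k \<le> n - 1 \<longrightarrow> b n n k = col_sum a (n - 1) (k - 1)) \<and>
     (\<forall>k. 1 \<le> k \<and> k \<le> n - 2 \<longrightarrow> b n (n - 1) k = col_sum a (n - 1) k) \<and>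
     (\<forall>m k. 2 \<le> k + 1 \<and> k + 1 \<le> m \<and> m \<le> n - 2 \<longrightarrow>
        b n (m + 1) k - b n m k = a (n - 1) m k) \<and>
     (\<forall>m k. 3 \<le> m + 2 \<and> m + 2 \<le> k \<and> k \<le> n - 1 \<longrightarrow>
        b n (m + 1) k - b n m k = a (n - 1) m (k - 1)))"

definition TS5 :: "(nat \<Rightarrow> nat \<Rightarrow> nat \<Rightarrow> int) \<Rightarrow> (nat \<Rightarrow> nat \<Rightarrow> nat \<Rightarrow> int) \<Rightarrow> bool" where
  "TS5 a b \<longleftrightarrow> (\<forall>n\<ge>3.
     (\<forall>k. 2 \<le> k \<and> k \<le> n - 1 \<longrightarrow> a n 1 k = col_sum b (n - 1) (k - 1)) \<and>
     (\<forall>m k. 3 \<le> m + 2 \<and> m + 2 \<le> k \<and> k \<le> n - 1 \<longrightarrow>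
        a n (m + 1) k - a n m k = - b (n - 1) m (k - 1)) \<and>
     (\<forall>m k. 2 \<le> k + 1 \<and> k + 1 \<le> m \<and> m \<le> n - 1 \<longrightarrow>
        a n (m + 1) k - a n m k = - b (n - 1) m k))"

definition twin_seidel :: "(nat \<Rightarrow> nat \<Rightarrow> nat \<Rightarrow> int) \<Rightarrow> (nat \<Rightarrow> nat \<Rightarrow> nat \<Rightarrow> int) \<Rightarrow> bool" where
  "twin_seidel a b \<longleftrightarrow>
     nonneg_entries a \<and> nonneg_entries b \<and> TS1 a b \<and> TS2 a b \<and> TS3 a b \<and> TS4 a b \<and> TS5 a b"

text \<open>Both kinds of objects exist and are unique on the relevant index range, so quantifying over
  all of them in a statement amounts to speaking about the one that the conditions determine.\<close>

function entringer_ex :: "nat \<Rightarrow> nat \<Rightarrow> int" where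
  "entringer_ex n k =
     (if n = 0 \<or> k = 0 \<or> n < k then 0 else if n = 1 then 1 else if k = n then 0
      else entringer_ex n (k + 1) + entringer_ex (n - 1) (n - k))"
  by pat_completeness auto
termination
  by (relation "measures [\<lambda>(n, k). n, \<lambda>(n, k). n - k]") auto

declare entringer_ex.simps [simp del]

lemma entringer_array_exists: "\<exists>e. entringer_array e"
proof
  have "entringer_ex n (m + 1) - entringer_ex n m + entringer_ex (n - 1) (n - m) = 0"
    if "n \<ge> 2" "m \<in> {1..n-1}" for n m
    using that by (subst (2) entringer_ex.simps) auto
  moreover have "entringer_ex 1 1 = 1" by (subst entringer_ex.simps) auto
  moreover have "entringer_ex n n = 0" if "n \<ge> 2" for n
    using that by (subst entringer_ex.simps) auto
  ultimately show "entringer_array entringer_ex"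
    unfolding entringer_array_def by blast
qed

lemma entringer_array_unique:
  assumes e: "entringer_array e" and e': "entringer_array e'"
  shows "n \<ge> 1 \<Longrightarrow> k \<in> {1..n} \<Longrightarrow> e n k = e' n k"
proof (induction n arbitrary: k rule: nat_induct_at_least)
  case base
  then show ?case using e e' by (auto simp: entringer_array_def)
next
  case (Suc n)
  have "k \<le> Suc n \<Longrightarrow> 1 \<le> k \<longrightarrow> e (Suc n) k = e' (Suc n) k" for k
  proof (induction k rule: inc_induct)
    case base
    show ?case using e e' Suc.hyps by (auto simp: entringer_array_def)
  next
    case (step m)
    show ?case
    proof
      assume m: "1 \<le> m"
      have "e (Suc n) (m + 1) - e (Suc n) m + e n (Suc n - m) = 0"
        "e' (Suc n) (m + 1) - e' (Suc n) m + e' n (Suc n - m) = 0"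
        using e e' Suc.hyps m step.hyps unfolding entringer_array_def
        by (metis Suc_1 Suc_le_mono atLeastAtMost_iff diff_Suc_1 less_Suc_eq_le)+
      moreover have "e n (Suc n - m) = e' n (Suc n - m)"
        using m step.hyps by (intro Suc.IH) auto
      ultimately show "e (Suc n) m = e' (Suc n) m" using step.IH by simp
    qed
  qed
  then show ?case using Suc.prems by auto
qed

fun twin_ex :: "nat \<Rightarrow> (nat \<Rightarrow> nat \<Rightarrow> int) \<times> (nat \<Rightarrow> nat \<Rightarrow> int)" where
  "twin_ex 0 = (\<lambda>m k. if m = 1 \<and> k = 1 then 1 else 0, \<lambda>m k. if m = 2 \<and> k = 1 then 1 else 0)"
| "twin_ex (Suc j) =
    (\<lambda>m k. if m = k \<or> j + 3 \<le> k \<or> j + 3 \<le> m then 0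
       else if m < k then (\<Sum>i=m..j+2. snd (twin_ex j) i (k - 1))
       else (\<Sum>i=m..j+2. snd (twin_ex j) i k),
     \<lambda>m k. if m = k \<or> j + 3 \<le> k then 0
       else if m < k then (\<Sum>i=1..<m. fst (twin_ex j) i (k - 1))
       else if m \<le> j + 2 then (\<Sum>i=1..<m. fst (twin_ex j) i k)
       else if k \<le> 1 then 0 else (\<Sum>i=1..j+2. fst (twin_ex j) i (k - 1)))"

lemma twin_ex_nonneg: "fst (twin_ex j) m k \<ge> 0 \<and> snd (twin_ex j) m k \<ge> 0"
  by (induction j arbitrary: m k) (auto simp del: sum.cl_ivl_Suc intro!: sum_nonneg)

lemma twin_seidel_exists: "\<exists>a b. twin_seidel a b"
proof (intro exI)
  define a where "a n = fst (twin_ex (n - 2))" for n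
  define b where "b n = snd (twin_ex (n - 2))" for n
  have a_last: "a n n k = 0" if "n \<ge> 2" for n k
    using that by (cases "n - 2") (auto simp: a_def)
  have a_rec: "a n m k = (if m = k \<or> n \<le> k \<or> n \<le> m then 0
       else if m < k then (\<Sum>i=m..n-1. b (n-1) i (k - 1)) else (\<Sum>i=m..n-1. b (n-1) i k))"
    and b_rec: "b n m k = (if m = k \<or> n \<le> k then 0
       else if m < k then (\<Sum>i=1..<m. a (n-1) i (k - 1))
       else if m \<le> n - 1 then (\<Sum>i=1..<m. a (n-1) i k)
       else if k \<le> 1 then 0 else (\<Sum>i=1..n-1. a (n-1) i (k - 1)))" if "n \<ge> 3" for n m k
  proof -
    define j where "j = n - 3"
    with that have n: "n = j + 3" by simp
    have n': "j + 3 - 2 = Suc j" "j + 3 - 1 = j + 2" "j + 2 - 2 = j" by simp_all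
    show "a n m k = (if m = k \<or> n \<le> k \<or> n \<le> m then 0
       else if m < k then (\<Sum>i=m..n-1. b (n-1) i (k - 1)) else (\<Sum>i=m..n-1. b (n-1) i k))"
      unfolding a_def b_def n n' twin_ex.simps fst_conv by (rule refl)
    show "b n m k = (if m = k \<or> n \<le> k then 0
       else if m < k then (\<Sum>i=1..<m. a (n-1) i (k - 1))
       else if m \<le> n - 1 then (\<Sum>i=1..<m. a (n-1) i k)
       else if k \<le> 1 then 0 else (\<Sum>i=1..n-1. a (n-1) i (k - 1)))"
      unfolding a_def b_def n n' twin_ex.simps snd_conv by (rule refl)
  qed
  have base: "a 2 = (\<lambda>m k. if m = 1 \<and> k = 1 then 1 else 0)"
    "b 2 = (\<lambda>m k. if m = 2 \<and> k = 1 then 1 else 0)"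
    by (simp_all add: a_def b_def)
  have two: "n = 2 \<or> n \<ge> 3" if "n \<ge> 2" for n :: nat using that by auto
  have "nonneg_entries a" "nonneg_entries b"
    using twin_ex_nonneg by (auto simp: nonneg_entries_def a_def b_def)
  moreover have "TS1 a b"
    unfolding TS1_def
  proof (intro allI impI ballI)
    fix n m :: nat assume "n \<ge> 2"
    with two consider "n = 2" | "n \<ge> 3" by blast
    then show "a n m m = (if n = 2 \<and> m = 1 then 1 else 0) \<and> b n m m = 0"
      by cases (auto simp: base a_rec b_rec)
  qed
  moreover have "TS2 a b"
    unfolding TS2_def by (auto simp: a_rec b_rec)
  moreover have "TS3 a b"
    by (auto simp: TS3_def base)
  moreover have "TS4 a b"
    unfolding TS4_def
  proof (intro allI impI conjI)
    fix n k :: nat assume n: "n \<ge> 3" and k: "1 \<le> k \<and> k \<le> n - 2"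
    have "{1..n-1} = insert (n-1) {1..<n-1}" using n by auto
    then show "b n (n - 1) k = col_sum a (n - 1) k"
      using n k a_last[of "n-1" k] by (auto simp: b_rec col_sum_def)
  qed (auto simp: b_rec col_sum_def)
  moreover have "TS5 a b"
    unfolding TS5_def
  proof (intro allI impI conjI)
    fix n m k :: nat assume n: "n \<ge> 3" and *: "3 \<le> m + 2 \<and> m + 2 \<le> k \<and> k \<le> n - 1"
    have "{m..n-1} = insert m {m+1..n-1}" using * by auto
    then show "a n (m + 1) k - a n m k = - b (n - 1) m (k - 1)"
      using n * by (auto simp: a_rec)
  next
    fix n m k :: nat assume n: "n \<ge> 3" and *: "2 \<le> k + 1 \<and> k + 1 \<le> m \<and> m \<le> n - 1"
    have "{m..n-1} = insert m {m+1..n-1}" using * by auto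
    then show "a n (m + 1) k - a n m k = - b (n - 1) m k"
      using n * by (auto simp: a_rec)
  qed (auto simp: a_rec col_sum_def)
  ultimately show "twin_seidel a b" by (simp add: twin_seidel_def)
qed

lemma TS4D:
  assumes "TS4 a b" "n \<ge> 3"
  shows "2 \<le> k \<Longrightarrow> k \<le> n - 1 \<Longrightarrow> b n n k = col_sum a (n - 1) (k - 1)"
    "1 \<le> k \<Longrightarrow> k \<le> n - 2 \<Longrightarrow> b n (n - 1) k = col_sum a (n - 1) k"
    "1 \<le> k \<Longrightarrow> k < m \<Longrightarrow> m \<le> n - 2 \<Longrightarrow> b n (m + 1) k - b n m k = a (n - 1) m k"
    "1 \<le> m \<Longrightarrow> m + 2 \<le> k \<Longrightarrow> k \<le> n - 1 \<Longrightarrow> b n (m + 1) k - b n m k = a (n - 1) m (k - 1)"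
  using assms unfolding TS4_def by simp_all

lemma TS5D:
  assumes "TS5 a b" "n \<ge> 3"
  shows "2 \<le> k \<Longrightarrow> k \<le> n - 1 \<Longrightarrow> a n 1 k = col_sum b (n - 1) (k - 1)"
    "1 \<le> m \<Longrightarrow> m + 2 \<le> k \<Longrightarrow> k \<le> n - 1 \<Longrightarrow> a n (m + 1) k - a n m k = - b (n - 1) m (k - 1)"
    "1 \<le> k \<Longrightarrow> k < m \<Longrightarrow> m \<le> n - 1 \<Longrightarrow> a n (m + 1) k - a n m k = - b (n - 1) m k"
  using assms unfolding TS5_def by simp_all

lemma twin_seidel_unique:
  assumes "twin_seidel a b" and "twin_seidel a' b'"
  shows "n \<ge> 2 \<Longrightarrow> m \<in> {1..n} \<Longrightarrow> k \<in> {1..n} \<Longrightarrow> a n m k = a' n m k \<and> b n m k = b' n m k"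
proof (induction n arbitrary: m k rule: nat_induct_at_least)
  case base
  then have "m = 1 \<or> m = 2" "k = 1 \<or> k = 2" by auto
  then show ?case using assms unfolding twin_seidel_def TS3_def by fastforce
next
  case (Suc n)
  let ?N = "Suc n"
  note ts = assms[unfolded twin_seidel_def]
  have t4: "TS4 a b" and t4': "TS4 a' b'" and t5: "TS5 a b" and t5': "TS5 a' b'"
    using ts by auto
  have N: "?N \<ge> 3" using Suc.hyps by simp
  have col: "col_sum a n k = col_sum a' n k" "col_sum b n k = col_sum b' n k"
    if "1 \<le> k" "k \<le> n" for k
    using Suc.IH that by (auto simp: col_sum_def intro!: sum.cong)
  have T1: "a ?N m m = a' ?N m m \<and> b ?N m m = b' ?N m m" if "m \<in> {1..?N}" for m
    using ts Suc.hyps that unfolding TS1_def by auto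
  have T2: "a ?N m ?N = a' ?N m ?N \<and> b ?N m ?N = b' ?N m ?N"
      "a ?N ?N m = a' ?N ?N m \<and> b ?N 1 m = b' ?N 1 m" "b ?N ?N 1 = b' ?N ?N 1"
    if "m \<in> {1..?N}" for m
    using ts N that unfolding TS2_def by auto
  have pred: "k - 1 \<in> {1..n}" "1 \<le> k - 1" "k - 1 \<le> n" if "2 \<le> k" "k \<le> n" for k
    using that by auto
  have T4_1: "b ?N ?N k = b' ?N ?N k" if "2 \<le> k" "k \<le> n" for k
    using TS4D(1)[OF t4 N, of k] TS4D(1)[OF t4' N, of k] col(1)[OF pred(2,3)[OF that]] that
    by simp
  have T4_2: "b ?N n k = b' ?N n k" if "1 \<le> k" "k < n" for k
    using TS4D(2)[OF t4 N, of k] TS4D(2)[OF t4' N, of k] col(1)[of k] that by simp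
  have T4_3: "b ?N (Suc m) k - b ?N m k = b' ?N (Suc m) k - b' ?N m k"
    if "1 \<le> k" "k < m" "m < n" for m k
    using TS4D(3)[OF t4 N, of k m] TS4D(3)[OF t4' N, of k m] Suc.IH[of m k] that by simp
  have T4_4: "b ?N (Suc m) k - b ?N m k = b' ?N (Suc m) k - b' ?N m k"
    if "1 \<le> m" "m + 2 \<le> k" "k \<le> n" for m k
    using TS4D(4)[OF t4 N, of m k] TS4D(4)[OF t4' N, of m k] Suc.IH[of m "k - 1"] pred(1)[of k] that
    by simp
  have T5_1: "a ?N 1 k = a' ?N 1 k" if "2 \<le> k" "k \<le> n" for k
    using TS5D(1)[OF t5 N, of k] TS5D(1)[OF t5' N, of k] col(2)[OF pred(2,3)[OF that]] that
    by simp
  have T5_2: "a ?N (Suc m) k - a ?N m k = a' ?N (Suc m) k - a' ?N m k"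
    if "1 \<le> m" "m + 2 \<le> k" "k \<le> n" for m k
    using TS5D(2)[OF t5 N, of m k] TS5D(2)[OF t5' N, of m k] Suc.IH[of m "k - 1"] pred(1)[of k] that
    by simp
  have T5_3: "a ?N (Suc m) k - a ?N m k = a' ?N (Suc m) k - a' ?N m k"
    if "1 \<le> k" "k < m" "m \<le> n" for m k
    using TS5D(3)[OF t5 N, of k m] TS5D(3)[OF t5' N, of k m] Suc.IH[of m k] that by simp
  have up: "a ?N m k = a' ?N m k \<and> b ?N m k = b' ?N m k" if "1 \<le> m" "m < k" "k \<le> n" for m k
    using that
  proof (induction m rule: nat_induct_at_least)
    case base
    then show ?case using T5_1[of k] T2(2)[of k] by auto
  next
    case (Suc m)
    then show ?case using T4_4[of m k] T5_2[of m k] by auto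
  qed
  have lowa: "k < m \<longrightarrow> a ?N m k = a' ?N m k" if "1 \<le> k" "k \<le> n" "m \<le> ?N" for m k
    using that(3)
  proof (induction m rule: inc_induct)
    case base
    then show ?case using T2(2)[of k] that by auto
  next
    case (step m)
    then show ?case using T5_3[of k m] that by auto
  qed
  have lowb: "k < m \<longrightarrow> b ?N m k = b' ?N m k" if "1 \<le> k" "k \<le> n" "m \<le> n" for m k
    using that(3)
  proof (induction m rule: inc_induct)
    case base
    then show ?case using T4_2[of k] that by auto
  next
    case (step m)
    then show ?case using T4_3[of k m] that by auto
  qed
  consider "m = k" | "k = ?N" | "m < k" "k \<le> n" | "k < m" "m \<le> n" | "m = ?N" "k = 1"
    | "m = ?N" "2 \<le> k" "k \<le> n"
    using Suc.prems by fastforce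
  then show ?case
    using T1[of m] T2(1)[of m] T2(2)[of k] T2(3)[of 1] T4_1[of k] up[of m k] lowa[of k m]
      lowb[of k m] Suc.prems
    by cases auto
qed

end

theory Submission
  imports Defs
begin

text \<open>
  Attaching signs to the Entringer array turns its recurrence into
  \<open>D (i + 1) j = D i (j + 1) - D i j\<close>, so its two border sequences are binomial transforms of each
  other; separating parities this says that the even part \<open>C\<close> and the odd part \<open>S\<close> of the exponential
  generating function of the row totals satisfy \<open>cos C = 1\<close> and \<open>S = sin C\<close>.

  For the matrices, the row sums follow from the differences of consecutive rows. The column sums go
  by induction on \<open>n\<close>: knowing the earlier column sums, the entries on each side of the diagonal form a
  three-parameter array whose second differences in two of the directions agree, and therefore
  \<open>a\<^sub>n(m,k) = a\<^sub>n(n-k,n-m)\<close>, which exchanges column sums and row sums of \<open>a\<^sub>n\<close>. The column sums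
  of \<open>b\<^sub>n\<close> are then a difference between the lower and the upper array next to the diagonal, where
  the two arrays coincide.
\<close>

unbundle fps_syntax

section \<open>The Entringer array and its signed form\<close>

locale entringer =
  fixes e :: "nat \<Rightarrow> nat \<Rightarrow> int"
  assumes array: "entringer_array e"
begin

lemma e_1_1: "e 1 1 = 1"
  using array by (simp add: entringer_array_def)

lemma e_diag: "n \<ge> 2 \<Longrightarrow> e n n = 0"
  using array by (simp add: entringer_array_def)

lemma e_rec:
  assumes "1 \<le> m" "m < n"
  shows "e n m = e n (m + 1) + e (n - 1) (n - m)"
proof -
  have "e n (m + 1) - e n m + e (n - 1) (n - m) = 0"
    using array assms unfolding entringer_array_def by auto
  then show ?thesis by simp
qed

lemma e_step: "e (i + j + 2) (i + 1) = e (i + j + 2) (i + 2) + e (i + j + 1) (j + 1)"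
  using e_rec[of "i + 1" "i + j + 2"] by simp

text \<open>One step of the recurrence lands in the previous row read backwards and a second one
  undoes the reversal, so second differences along a row give minus the row two sizes
  smaller.\<close>

lemma e_second_difference:
  "e (i + j + 3) (i + 1) - 2 * e (i + j + 3) (i + 2) + e (i + j + 3) (i + 3) = - e (i + j + 1) (i + 1)"
  using e_step[of i "j + 1"] e_step[of "i + 1" j] e_step[of j i]
  by (simp add: add_ac numeral_3_eq_3)

text \<open>Read backwards, row \<open>n\<close> lists the successive differences of row
  \<open>n + 1\<close>, whose last entry is 0.\<close>

lemma sum_e:
  assumes "n \<ge> 1"
  shows "(\<Sum>k=1..n. e n k) = e (n + 1) 1"
proof -
  have "p \<le> n \<Longrightarrow> (\<Sum>k=1..p. e n k) = e (n + 1) (n + 1 - p)" for p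
  proof (induction p)
    case 0
    then show ?case using e_diag[of "n + 1"] assms by simp
  next
    case (Suc p)
    then show ?case using e_rec[of "n - p" "n + 1"] by (simp add: Suc_diff_le)
  qed
  from this[of n] show ?thesis by simp
qed

text \<open>The boustrophedon arrangement: the antidiagonal \<open>i + j = s\<close> carries row
  \<open>s + 1\<close> of \<open>e\<close>, read in alternating directions to absorb the index
  reversal in the recurrence.\<close>

definition signed_e :: "nat \<Rightarrow> nat \<Rightarrow> int" where
  "signed_e i j = (- 1) ^ ((i + j + 1) div 2) *
     (if even (i + j) then e (i + j + 1) (i + 1) else e (i + j + 1) (j + 1))"

lemma signed_e_Suc: "signed_e (Suc i) j = signed_e i (Suc j) - signed_e i j"
proof (cases "even (i + j)")
  case True
  then obtain p where p: "i + j = 2 * p" by blast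
  then show ?thesis
    using e_step[of j i] by (simp add: signed_e_def algebra_simps)
next
  case False
  then obtain p where p: "i + j = 2 * p + 1" by (rule oddE)
  then show ?thesis
    using e_step[of i j] by (simp add: signed_e_def algebra_simps)
qed

end

text \<open>A step in the first index acts as (shift - 1) on the second, so this is the binomial
  theorem for a power of that operator.\<close>

lemma difference_binomial_expansion:
  fixes D :: "nat \<Rightarrow> nat \<Rightarrow> 'a :: comm_ring_1"
  assumes "\<And>i j. D (Suc i) j = D i (Suc j) - D i j"
  shows "D i j = (\<Sum>r\<le>i. of_nat (i choose r) * (- 1) ^ (i - r) * D 0 (j + r))"
proof (induction i arbitrary: j)
  case 0
  then show ?case by simp
next
  case (Suc i)
  have 1: "D i (Suc j) = (\<Sum>r=1..Suc i. of_nat (i choose (r - 1)) * (- 1) ^ (Suc i - r) * D 0 (j + r))"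
    unfolding Suc.IH[of "Suc j"] One_nat_def sum.shift_bounds_cl_Suc_ivl by (simp add: atLeast0AtMost)
  have 2: "- D i j = (\<Sum>r\<le>Suc i. of_nat (i choose r) * (- 1) ^ (Suc i - r) * D 0 (j + r))"
    unfolding Suc.IH[of j] by (simp add: sum_negf[symmetric] Suc_diff_le binomial_eq_0)
  have 3: "D i (Suc j) = (\<Sum>r\<le>Suc i.
      (if r = 0 then 0 else of_nat (i choose (r - 1))) * (- 1) ^ (Suc i - r) * D 0 (j + r))"
    unfolding 1 by (intro sum.mono_neutral_cong_left) auto
  have "D (Suc i) j = D i (Suc j) + - D i j" using assms by simp
  also have "\<dots> = (\<Sum>r\<le>Suc i.
      ((if r = 0 then 0 else of_nat (i choose (r - 1))) + of_nat (i choose r)) * (- 1) ^ (Suc i - r) * D 0 (j + r))"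
    unfolding 2 3 sum.distrib[symmetric] by (simp only: distrib_right)
  also have "\<dots> = (\<Sum>r\<le>Suc i. of_nat (Suc i choose r) * (- 1) ^ (Suc i - r) * D 0 (j + r))"
    by (rule sum.cong[OF refl], rename_tac r, case_tac r) auto
  finally show ?case .
qed

section \<open>Tangent and secant generating functions\<close>

context entringer
begin

text \<open>The zeros \<open>e n n\<close> kill opposite parities on the two borders: totals with
  odd \<open>n\<close> survive here, those with even \<open>n\<close> on
  \<open>signed_e 0 n\<close>.\<close>

lemma signed_e_0_right:
  "signed_e n 0 = (if n = 0 then 1 else if even n then 0 else (- 1) ^ ((n + 1) div 2) * e (n + 1) 1)"
  using e_1_1 e_diag[of "n + 1"] by (auto simp: signed_e_def)

lemma signed_e_0_left: "signed_e 0 n = (if even n then (- 1) ^ (n div 2) * e (n + 1) 1 else 0)"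
  using e_diag[of "n + 1"] by (auto simp: signed_e_def elim: oddE)

text \<open>In exponential generating functions, the border \<open>signed_e n 0\<close> is exp(-x)
  times the border \<open>signed_e 0 n\<close>.\<close>

lemma signed_e_convolution:
  "(\<Sum>j=0..n. (- 1) ^ (n - j) / fact (n - j) * (of_int (signed_e 0 j) / fact j)) =
   (of_int (signed_e n 0) / fact n :: real)"
proof -
  have "(of_int (signed_e n 0) :: real) =
      (\<Sum>j\<le>n. of_nat (n choose j) * (- 1) ^ (n - j) * of_int (signed_e 0 (0 + j)))"
    using difference_binomial_expansion[of "\<lambda>i j. of_int (signed_e i j) :: real" n 0]
    by (simp add: signed_e_Suc)
  then show ?thesis
    by (simp add: sum_divide_distrib binomial_fact atLeast0AtMost field_simps)
qed

definition even_egf :: "real fps" where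
  "even_egf = Abs_fps (\<lambda>n. if even n then of_int (e (n + 1) 1) / fact n else 0)"

lemma cos_even_egf: "fps_cos 1 * even_egf = 1"
proof (rule fps_ext)
  fix n
  show "(fps_cos 1 * even_egf) $ n = 1 $ n"
  proof (cases "even n")
    case True
    then obtain p where n: "n = 2 * p" by blast
    have "(fps_cos 1 * even_egf) $ n = (\<Sum>j=0..n. fps_cos 1 $ (n - j) * even_egf $ j)"
      unfolding mult.commute[of "fps_cos 1"] fps_mult_nth by (simp only: mult.commute)
    also have "\<dots> = (\<Sum>j=0..n. (- 1) ^ p *
        ((- 1) ^ (n - j) / fact (n - j) * (of_int (signed_e 0 j) / fact j)))"
    proof (rule sum.cong[OF refl])
      fix j assume j: "j \<in> {0..n}"
      show "fps_cos 1 $ (n - j) * even_egf $ j = (- 1) ^ p *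
        ((- 1) ^ (n - j) / fact (n - j) * (of_int (signed_e 0 j) / fact j))"
      proof (cases "even j")
        case True
        then obtain q where q: "j = 2 * q" by blast
        then have "n - j = 2 * (p - q)" "q \<le> p" using n j by auto
        then have "p = (p - q) + q" by simp
        \<comment> \<open>The cosine coefficient contributes \<open>(- 1) ^ (p - q)\<close> and
          undoing the sign of \<open>signed_e 0 j\<close> contributes \<open>(- 1) ^ q\<close>, so
          the total sign does not depend on \<open>j\<close>.\<close>
        then have "(-1::real) ^ p = (- 1) ^ (p - q) * (- 1) ^ q" by (metis power_add)
        then show ?thesis using \<open>n - j = _\<close> q
          by (simp add: fps_cos_def even_egf_def signed_e_0_left power_mult_distrib[symmetric])
      qed (simp add: even_egf_def signed_e_0_left)
    qed
    also have "\<dots> = (- 1) ^ p * (of_int (signed_e n 0) / fact n)"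
      by (simp only: sum_distrib_left[symmetric] signed_e_convolution)
    finally show ?thesis using n by (simp add: signed_e_0_right)
  next
    case False
    then show ?thesis
      by (auto simp: fps_mult_nth fps_cos_def even_egf_def odd_pos intro!: sum.neutral)
  qed
qed

lemma sin_even_egf: "fps_sin 1 * even_egf =
    Abs_fps (\<lambda>n. if odd n then of_int (e (n + 1) 1) / fact n else 0)"
proof (rule fps_ext)
  fix n
  show "(fps_sin 1 * even_egf) $ n =
      Abs_fps (\<lambda>n. if odd n then of_int (e (n + 1) 1) / fact n else 0) $ n"
  proof (cases "odd n")
    case True
    then obtain p where n: "n = 2 * p + 1" by (rule oddE)
    have "(fps_sin 1 * even_egf) $ n = (\<Sum>j=0..n. fps_sin 1 $ (n - j) * even_egf $ j)"
      unfolding mult.commute[of "fps_sin 1"] fps_mult_nth by (simp only: mult.commute)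
    \<comment> \<open>For even \<open>j\<close> now \<open>n - j\<close> is odd; the extra sign in
      \<open>p + 1\<close> compensates \<open>(- 1) ^ (n - j)\<close>.\<close>
    also have "\<dots> = (\<Sum>j=0..n. (- 1) ^ (p + 1) *
        ((- 1) ^ (n - j) / fact (n - j) * (of_int (signed_e 0 j) / fact j)))"
    proof (rule sum.cong[OF refl])
      fix j assume j: "j \<in> {0..n}"
      show "fps_sin 1 $ (n - j) * even_egf $ j = (- 1) ^ (p + 1) *
        ((- 1) ^ (n - j) / fact (n - j) * (of_int (signed_e 0 j) / fact j))"
      proof (cases "even j")
        case True
        then obtain q where q: "j = 2 * q" by blast
        then have "n - j = 2 * (p - q) + 1" "q \<le> p" using n j by auto
        then have "p = (p - q) + q" by simp
        then have "(-1::real) ^ p = (- 1) ^ (p - q) * (- 1) ^ q" by (metis power_add)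
        then show ?thesis using \<open>n - j = _\<close> q
          by (simp add: fps_sin_def even_egf_def signed_e_0_left power_mult_distrib[symmetric] del: fact_Suc)
      qed (simp add: even_egf_def signed_e_0_left)
    qed
    also have "\<dots> = (- 1) ^ (p + 1) * (of_int (signed_e n 0) / fact n)"
      by (simp only: sum_distrib_left[symmetric] signed_e_convolution)
    finally show ?thesis using n by (simp add: signed_e_0_right)
  next
    case False
    then show ?thesis
      by (auto simp: fps_mult_nth fps_sin_def even_egf_def intro!: sum.neutral)
  qed
qed

lemma e_first_eq_tan_sec_number: "of_int (e (n + 1) 1) = tan_sec_number n"
proof -
  have "inverse (fps_cos 1) = even_egf"
    using cos_even_egf by (rule fps_inverse_unique)
  moreover have "fps_tan 1 = fps_sin 1 * inverse (fps_cos (1::real))"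
    unfolding fps_tan_def by (rule fps_divide_unit) simp
  ultimately have "tan_sec_number n = fact n * (fps_sin 1 * even_egf + even_egf) $ n"
    by (simp add: tan_sec_number_def)
  then show ?thesis
    unfolding sin_even_egf by (simp add: even_egf_def)
qed

lemma sum_e_eq_tan_sec_number: "n \<ge> 1 \<Longrightarrow> of_int (\<Sum>k=1..n. e n k) = tan_sec_number n"
  by (simp only: sum_e e_first_eq_tan_sec_number)

end

section \<open>Discrete rotation arrays and their symmetry\<close>

text \<open>In generating functions, \<open>\<partial>\<^sub>l - \<partial>\<^sub>j\<close> maps \<open>rotX\<close> to \<open>rotY\<close> and \<open>rotY\<close> to \<open>- rotX\<close>.\<close>

fun rotX :: "(nat \<Rightarrow> nat \<Rightarrow> int) \<Rightarrow> (nat \<Rightarrow> nat \<Rightarrow> int) \<Rightarrow> nat \<Rightarrow> nat \<Rightarrow> nat \<Rightarrow> int"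
  and rotY :: "(nat \<Rightarrow> nat \<Rightarrow> int) \<Rightarrow> (nat \<Rightarrow> nat \<Rightarrow> int) \<Rightarrow> nat \<Rightarrow> nat \<Rightarrow> nat \<Rightarrow> int" where
  "rotX f g i j 0 = f i j"
| "rotX f g i j (Suc l) = rotX f g i (Suc j) l + rotY f g i j l"
| "rotY f g i j 0 = g i j"
| "rotY f g i j (Suc l) = rotY f g i (Suc j) l - rotX f g i j l"

lemma rotX_unroll: "rotX f g i j l = f i (j + l) + (\<Sum>r<l. rotY f g i (j + l - Suc r) r)"
  by (induction l arbitrary: j) simp_all

lemma rotX_second_difference_right:
  "rotX f g i j (Suc (Suc l)) = 2 * rotX f g i (Suc j) (Suc l)
     - rotX f g i (Suc (Suc j)) l - rotX f g i j l"
  by simp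

text \<open>The step in \<open>l\<close> is linear and commutes with shifts of \<open>i\<close> and
  \<open>j\<close>, so it carries the law assumed at \<open>l = 0\<close> to all
  \<open>l\<close>.\<close>

lemma rot_second_difference_left:
  assumes f: "\<And>i j. f (Suc (Suc i)) j = 2 * f (Suc i) (Suc j) - f i (Suc (Suc j)) - f i j"
    and g: "\<And>i j. g (Suc (Suc i)) j = 2 * g (Suc i) (Suc j) - g i (Suc (Suc j)) - g i j"
  shows "rotX f g (Suc (Suc i)) j l = 2 * rotX f g (Suc i) (Suc j) l
     - rotX f g i (Suc (Suc j)) l - rotX f g i j l
    \<and> rotY f g (Suc (Suc i)) j l = 2 * rotY f g (Suc i) (Suc j) l
     - rotY f g i (Suc (Suc j)) l - rotY f g i j l"
  by (induction l arbitrary: i j) (simp_all add: f g)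

text \<open>The same second-order recurrence holds in \<open>i\<close> and in \<open>l\<close>, so
  only \<open>i, l < 2\<close> needs checking; there \<open>fg\<close> compares (1, 0) with (0, 1),
  the only nontrivial case.\<close>

lemma rotX_symmetric:
  assumes f: "\<And>i j. f (Suc (Suc i)) j = 2 * f (Suc i) (Suc j) - f i (Suc (Suc j)) - f i j"
    and g: "\<And>i j. g (Suc (Suc i)) j = 2 * g (Suc i) (Suc j) - g i (Suc (Suc j)) - g i j"
    and fg: "\<And>j. f 1 j = f 0 (Suc j) + g 0 j"
  shows "rotX f g i j l = rotX f g l j i"
proof (induction "i + l" arbitrary: i j l rule: less_induct)
  case less
  note left = rot_second_difference_left[of f g, OF f g, THEN conjunct1]
  consider i' where "i = Suc (Suc i')" | l' where "l = Suc (Suc l')" | "i < 2" "l < 2"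
    by (metis add_2_eq_Suc le_Suc_ex not_less)
  then show ?case
  proof cases
    case 1
    then show ?thesis
      using less[of i' l "Suc (Suc j)"] less[of i' l j] less[of "Suc i'" l "Suc j"]
      by (simp only: left rotX_second_difference_right)
  next
    case 2
    then show ?thesis
      using less[of i l' "Suc (Suc j)"] less[of i l' j] less[of i "Suc l'" "Suc j"]
      by (simp only: left rotX_second_difference_right)
  next
    case 3
    then show ?thesis using fg by (auto simp: less_2_cases_iff)
  qed
qed

context entringer
begin

text \<open>Coordinates of the entries of the twin Seidel matrices, with \<open>n = i + j + l + 3\<close>: below the
  diagonal \<open>lowX\<close> and \<open>lowY\<close> are \<open>a\<^sub>n\<close> and \<open>b\<^sub>n\<close> at \<open>(i + j + 2, i + 1)\<close>; above it \<open>uppX\<close> and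
  \<open>- uppY\<close> are \<open>a\<^sub>n\<close> and \<open>b\<^sub>n\<close> at \<open>(l + 1, l + j + 2)\<close>.\<close>

definition "lowX = rotX (\<lambda>i j. e (i + j + 1) (j + 1)) (\<lambda>i j. e (i + j + 2) (j + 1))"
definition "lowY = rotY (\<lambda>i j. e (i + j + 1) (j + 1)) (\<lambda>i j. e (i + j + 2) (j + 1))"
definition "uppX = rotX (\<lambda>i j. e (i + j + 2) (i + 1)) (\<lambda>i j. 0)"
definition "uppY = rotY (\<lambda>i j. e (i + j + 2) (i + 1)) (\<lambda>i j. 0)"

lemma low_simps:
  "lowX i j 0 = e (i + j + 1) (j + 1)"
  "lowX i j (Suc l) = lowX i (Suc j) l + lowY i j l"
  "lowY i j 0 = e (i + j + 2) (j + 1)"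
  "lowY i j (Suc l) = lowY i (Suc j) l - lowX i j l"
  by (simp_all add: lowX_def lowY_def)

lemma upp_simps:
  "uppX i j 0 = e (i + j + 2) (i + 1)"
  "uppX i j (Suc l) = uppX i (Suc j) l + uppY i j l"
  "uppY i j 0 = 0"
  "uppY i j (Suc l) = uppY i (Suc j) l - uppX i j l"
  by (simp_all add: uppX_def uppY_def)

lemma lowX_symmetric: "lowX i j l = lowX l j i"
  unfolding lowX_def
proof (rule rotX_symmetric)
  fix i j
  show "e (Suc (Suc i) + j + 1) (j + 1) =
      2 * e (Suc i + Suc j + 1) (Suc j + 1)
      - e (i + Suc (Suc j) + 1) (Suc (Suc j) + 1) - e (i + j + 1) (j + 1)"
    using e_second_difference[of j i] by (simp add: add_ac numeral_3_eq_3)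
  show "e (Suc (Suc i) + j + 2) (j + 1) =
      2 * e (Suc i + Suc j + 2) (Suc j + 1)
      - e (i + Suc (Suc j) + 2) (Suc (Suc j) + 1) - e (i + j + 2) (j + 1)"
    using e_second_difference[of j "i + 1"] by (simp add: add_ac numeral_3_eq_3)
  show "e (1 + j + 1) (j + 1) = e (0 + Suc j + 1) (Suc j + 1) + e (0 + j + 2) (j + 1)"
    using e_diag[of "j + 2"] by simp
qed

lemma uppX_symmetric: "uppX i j l = uppX l j i"
  unfolding uppX_def
proof (rule rotX_symmetric)
  fix i j
  show "e (Suc (Suc i) + j + 2) (Suc (Suc i) + 1) =
      2 * e (Suc i + Suc j + 2) (Suc i + 1)
      - e (i + Suc (Suc j) + 2) (i + 1) - e (i + j + 2) (i + 1)"
    using e_second_difference[of i "j + 1"] by (simp add: add_ac numeral_3_eq_3)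
  show "e (1 + j + 2) (1 + 1) = e (0 + Suc j + 2) (0 + 1) + 0"
    using e_step[of 0 "j + 1"] e_diag[of "j + 2"] by (simp add: add_ac numeral_3_eq_3)
qed simp

lemma uppX_unroll: "uppX l 0 i = e (l + i + 2) (l + 1) + (\<Sum>r<i. uppY l (i - Suc r) r)"
  unfolding uppX_def uppY_def by (subst rotX_unroll) simp

text \<open>By symmetry both entries are one step away from the common neighbour \<open>(i, 1, l)\<close>.\<close>

lemma lowX_antidiagonal: "lowX (Suc i) 0 l - lowX i 0 (Suc l) = lowY l 0 i - lowY i 0 l"
  using lowX_symmetric[of "Suc i" 0 l] lowX_symmetric[of l 1 i] by (simp add: low_simps)

lemma uppX_antidiagonal: "uppX (Suc i) 0 l - uppX i 0 (Suc l) = uppY l 0 i - uppY i 0 l"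
  using uppX_symmetric[of "Suc i" 0 l] uppX_symmetric[of l 1 i] by (simp add: upp_simps)

text \<open>By symmetry both values lie on the face with third index 0, where they are read off from
  \<open>e\<close>.\<close>

lemma lowX_eq_uppX_0: "lowX 0 0 l = uppX 0 0 l"
  using lowX_symmetric[of 0 0 l] uppX_symmetric[of 0 0 l] e_step[of l 0] e_diag[of "l + 2"]
  by (simp add: low_simps upp_simps)

end

text \<open>Prepares the comparison of a row of size \<open>Suc n\<close> with one of size
  \<open>n\<close>: beyond the diagonal the columns are shifted by one, so the larger row has one
  more entry to single out.\<close>

lemma sum_split_adjacent:
  assumes "1 \<le> m" "m \<le> (n::nat)"
  shows "(\<Sum>k=1..Suc n. f k) = (\<Sum>k=1..<m. f k) + f m + f (Suc m) + (\<Sum>k=Suc m..n. f (Suc k) :: int)"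
    "(\<Sum>k=1..n. f k) = (\<Sum>k=1..<m. f k) + f m + (\<Sum>k=Suc m..n. f k)"
proof -
  have *: "(\<Sum>k=1..p. f k) = (\<Sum>k=1..<m. f k) + f m + (\<Sum>k=Suc m..p. f k)" if "m \<le> p" for p
  proof -
    have "{1..p} = insert m ({1..<m} \<union> {Suc m..p})" using assms that by auto
    moreover have "sum f ({1..<m} \<union> {Suc m..p}) = sum f {1..<m} + sum f {Suc m..p}"
      by (rule sum.union_disjoint) auto
    ultimately show ?thesis by (simp del: One_nat_def)
  qed
  show "(\<Sum>k=1..n. f k) = (\<Sum>k=1..<m. f k) + f m + (\<Sum>k=Suc m..n. f k)" using * assms by simp
  have "(\<Sum>k=Suc m..Suc n. f k) = f (Suc m) + (\<Sum>k=Suc m..n. f (Suc k))"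
    using assms by (subst sum.atLeast_Suc_atMost) (simp_all add: sum.shift_bounds_cl_Suc_ivl del: sum.cl_ivl_Suc)
  then show "(\<Sum>k=1..Suc n. f k) = (\<Sum>k=1..<m. f k) + f m + f (Suc m) + (\<Sum>k=Suc m..n. f (Suc k))"
    using *[of "Suc n"] assms by (simp del: sum.cl_ivl_Suc)
qed

section \<open>Entries of the twin Seidel matrices\<close>

locale twin_entringer = entringer +
  fixes a b :: "nat \<Rightarrow> nat \<Rightarrow> nat \<Rightarrow> int"
  assumes twin: "twin_seidel a b"
begin

lemma base_entries:
  "a 2 1 1 = 1" "a 2 1 2 = 0" "a 2 2 1 = 0" "a 2 2 2 = 0"
  "b 2 1 1 = 0" "b 2 1 2 = 0" "b 2 2 1 = 1" "b 2 2 2 = 0"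
  using twin unfolding twin_seidel_def TS3_def by auto

lemma diag:
  "n \<ge> 3 \<Longrightarrow> 1 \<le> m \<Longrightarrow> m \<le> n \<Longrightarrow> a n m m = 0"
  "n \<ge> 2 \<Longrightarrow> 1 \<le> m \<Longrightarrow> m \<le> n \<Longrightarrow> b n m m = 0"
  using twin unfolding twin_seidel_def TS1_def by auto

lemma boundary:
  assumes "n \<ge> 2" "1 \<le> m" "m \<le> n"
  shows "a n m n = 0" "b n m n = 0" "a n n m = 0" "b n 1 m = 0"
proof -
  have "a n m n = 0 \<and> b n m n = 0 \<and> a n n m = 0 \<and> b n 1 m = 0"
  proof (cases "n = 2")
    case True
    then have "m = 1 \<or> m = 2" using assms by auto
    then show ?thesis using base_entries True by auto
  next
    case False
    then show ?thesis using twin assms unfolding twin_seidel_def TS2_def by auto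
  qed
  then show "a n m n = 0" "b n m n = 0" "a n n m = 0" "b n 1 m = 0" by auto
qed

lemma b_corner: "n \<ge> 3 \<Longrightarrow> b n n 1 = 0"
  using twin unfolding twin_seidel_def TS2_def by auto

text \<open>This and the next lemmas pass from size \<open>n\<close> to \<open>Suc n\<close> and
  write columns above the diagonal as \<open>Suc k\<close>, which avoids truncated
  subtraction.\<close>

lemma a_first_row: "1 \<le> k \<Longrightarrow> k < n \<Longrightarrow> a (Suc n) 1 (Suc k) = col_sum b n k"
  using TS5D(1)[of a b "Suc n" "Suc k"] twin by (simp add: twin_seidel_def)

lemma a_step_upper:
  "1 \<le> m \<Longrightarrow> m < k \<Longrightarrow> k < n \<Longrightarrow> a (Suc n) m (Suc k) = a (Suc n) (Suc m) (Suc k) + b n m k"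
  using TS5D(2)[of a b "Suc n" m "Suc k"] twin by (simp add: twin_seidel_def)

lemma a_step_lower:
  "1 \<le> k \<Longrightarrow> k < m \<Longrightarrow> m \<le> n \<Longrightarrow> a (Suc n) m k = a (Suc n) (Suc m) k + b n m k"
  using TS5D(3)[of a b "Suc n" k m] twin by (simp add: twin_seidel_def)

lemma b_last_row: "1 \<le> k \<Longrightarrow> k < n \<Longrightarrow> b (Suc n) (Suc n) (Suc k) = col_sum a n k"
  using TS4D(1)[of a b "Suc n" "Suc k"] twin by (simp add: twin_seidel_def)

lemma b_penultimate_row: "1 \<le> k \<Longrightarrow> k < n \<Longrightarrow> b (Suc n) n k = col_sum a n k"
  using TS4D(2)[of a b "Suc n" k] twin by (simp add: twin_seidel_def)

lemma b_step_lower: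
  "1 \<le> k \<Longrightarrow> k < m \<Longrightarrow> m < n \<Longrightarrow> b (Suc n) (Suc m) k = b (Suc n) m k + a n m k"
  using TS4D(3)[of a b "Suc n" k m] twin by (cases n) (simp_all add: twin_seidel_def)

lemma b_step_upper:
  "1 \<le> m \<Longrightarrow> m < k \<Longrightarrow> k < n \<Longrightarrow> b (Suc n) (Suc m) (Suc k) = b (Suc n) m (Suc k) + a n m k"
  using TS4D(4)[of a b "Suc n" m "Suc k"] twin by (simp add: twin_seidel_def)

text \<open>Telescopes down from the first row, a full column sum of \<open>b n\<close>;
  \<open>a_lower\<close> telescopes up from the zero last row. Both give tail sums of columns of
  \<open>b n\<close>, hence \<open>a_near_diag\<close>.\<close>

lemma a_upper: "1 \<le> m \<Longrightarrow> m \<le> k \<Longrightarrow> k < n \<Longrightarrow> a (Suc n) m (Suc k) = (\<Sum>i=m..n. b n i k)"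
proof (induction m rule: nat_induct_at_least)
  case base
  then show ?case by (simp add: a_first_row col_sum_def del: One_nat_def)
next
  case (Suc m)
  then show ?case using a_step_upper[of m k n] sum.atLeast_Suc_atMost[of m n "\<lambda>i. b n i k"] by simp
qed

lemma a_lower:
  assumes "1 \<le> k" "k < m" "m \<le> Suc n" "n \<ge> 2"
  shows "a (Suc n) m k = (\<Sum>i=m..n. b n i k)"
  using assms(3,2)
proof (induction m rule: inc_induct)
  case base
  then show ?case using boundary(3)[of "Suc n" k] assms by simp
next
  case (step m)
  then show ?case
    using a_step_lower[of k m n] sum.atLeast_Suc_atMost[of m n "\<lambda>i. b n i k"] assms by simp
qed

lemma b_upper: "1 \<le> m \<Longrightarrow> m \<le> k \<Longrightarrow> k < n \<Longrightarrow> b (Suc n) m (Suc k) = (\<Sum>i=1..<m. a n i k)"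
proof (induction m rule: nat_induct_at_least)
  case base
  then show ?case using boundary(4)[of "Suc n" "Suc k"] by simp
next
  case (Suc m)
  then show ?case using b_step_upper[of m k n] by simp
qed

lemma b_lower:
  assumes "1 \<le> k" "k < m" "m \<le> n"
  shows "b (Suc n) m k = (\<Sum>i=1..<m. a n i k)"
  using assms(3,2)
proof (induction m rule: inc_induct)
  case base
  have "col_sum a n k = (\<Sum>i=1..<n. a n i k) + a n n k"
    unfolding col_sum_def using base assms by (subst sum.last_plus) auto
  then show ?case using b_penultimate_row[of k n] boundary(3)[of n k] base assms by simp
next
  case (step m)
  then show ?case using b_step_lower[of k m n] assms by simp
qed

lemma a_near_diag:
  assumes "1 \<le> m" "m \<le> n" "n \<ge> 2"
  shows "a (Suc n) m (Suc m) = a (Suc n) (Suc m) m"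
proof (cases "m = n")
  case True
  then show ?thesis using boundary(1,3)[of "Suc n" n] assms by simp
next
  case False
  then show ?thesis
    using a_upper[of m m n] a_lower[of m "Suc m" n] diag(2)[of n m] assms
      sum.atLeast_Suc_atMost[of m n "\<lambda>i. b n i m"] by simp
qed

text \<open>The term \<open>a n m m\<close> vanishes for \<open>n \<ge> 3\<close> but is 1 for
  \<open>n = 2\<close>, \<open>m = 1\<close>.\<close>

lemma b_near_diag:
  "1 \<le> m \<Longrightarrow> m < n \<Longrightarrow> b (Suc n) (Suc m) m = b (Suc n) m (Suc m) + a n m m"
  using b_upper[of m m n] b_lower[of m "Suc m" n] by simp

section \<open>Row sums\<close>

lemma row_sum_a_step:
  assumes "1 \<le> m" "m \<le> n" "n \<ge> 2"
  shows "row_sum a (Suc n) m = row_sum a (Suc n) (Suc m) + row_sum b n m"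
proof -
  have 1: "(\<Sum>k=1..<m. a (Suc n) m k) = (\<Sum>k=1..<m. a (Suc n) (Suc m) k) + (\<Sum>k=1..<m. b n m k)"
    unfolding sum.distrib[symmetric] using assms by (intro sum.cong) (auto intro: a_step_lower)
  have "a (Suc n) m (Suc k) = a (Suc n) (Suc m) (Suc k) + b n m k" if "k \<in> {Suc m..n}" for k
    using that assms a_step_upper[of m k n] boundary(1)[of "Suc n" m] boundary(1)[of "Suc n" "Suc m"]
      boundary(2)[of n m] by (cases "k = n") auto
  then have 2: "(\<Sum>k=Suc m..n. a (Suc n) m (Suc k)) =
      (\<Sum>k=Suc m..n. a (Suc n) (Suc m) (Suc k)) + (\<Sum>k=Suc m..n. b n m k)"
    unfolding sum.distrib[symmetric] by (intro sum.cong) auto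
  \<comment> \<open>The diagonal entries vanish and the two entries beside the diagonal agree, so
    only the row of \<open>b n\<close> remains.\<close>
  show ?thesis
    unfolding row_sum_def sum_split_adjacent[OF assms(1,2)] 1 2
    using a_near_diag[OF assms] diag(1)[of "Suc n" m] diag(1)[of "Suc n" "Suc m"] diag(2)[of n m] assms
    by simp
qed

lemma row_sum_b_step:
  assumes "1 \<le> m" "m \<le> n" "n \<ge> 2"
  shows "row_sum b (Suc n) (Suc m) = row_sum b (Suc n) m + row_sum a n m"
proof (cases "m = n")
  \<comment> \<open>The last two rows both list the column sums of \<open>a n\<close>, the last one
    shifted right by one column.\<close>
  case True
  have s: "{1..n} = insert n {1..<n}" using assms by auto
  have "row_sum b (Suc n) (Suc n) = b (Suc n) (Suc n) 1 + (\<Sum>k=1..n. b (Suc n) (Suc n) (Suc k))"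
    unfolding row_sum_def
    by (subst sum.atLeast_Suc_atMost) (simp_all add: sum.shift_bounds_cl_Suc_ivl del: sum.cl_ivl_Suc)
  also have "\<dots> = (\<Sum>k=1..<n. b (Suc n) (Suc n) (Suc k))"
    unfolding s using b_corner[of "Suc n"] diag(2)[of "Suc n" "Suc n"] assms by simp
  also have "\<dots> = (\<Sum>k=1..<n. b (Suc n) n k)"
    by (intro sum.cong) (auto simp: b_last_row b_penultimate_row)
  also have "\<dots> = row_sum b (Suc n) n"
    unfolding row_sum_def sum_split_adjacent(1)[of n n, OF _ order_refl]
    using diag(2)[of "Suc n" n] boundary(2)[of "Suc n" n] assms
    by (subst sum_split_adjacent(1)[of n n]) auto
  moreover have "row_sum a n n = 0"
    unfolding row_sum_def using boundary(3)[of n] assms by (intro sum.neutral) auto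
  ultimately show ?thesis using True by simp
next
  case False
  have 1: "(\<Sum>k=1..<m. b (Suc n) (Suc m) k) = (\<Sum>k=1..<m. b (Suc n) m k) + (\<Sum>k=1..<m. a n m k)"
    unfolding sum.distrib[symmetric] using assms False by (intro sum.cong) (auto intro: b_step_lower)
  have "b (Suc n) (Suc m) (Suc k) = b (Suc n) m (Suc k) + a n m k" if "k \<in> {Suc m..n}" for k
    using that assms b_step_upper[of m k n] boundary(2)[of "Suc n" m] boundary(2)[of "Suc n" "Suc m"]
      boundary(1)[of n m] by (cases "k = n") auto
  then have 2: "(\<Sum>k=Suc m..n. b (Suc n) (Suc m) (Suc k)) =
      (\<Sum>k=Suc m..n. b (Suc n) m (Suc k)) + (\<Sum>k=Suc m..n. a n m k)"
    unfolding sum.distrib[symmetric] by (intro sum.cong) auto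
  show ?thesis
    unfolding row_sum_def sum_split_adjacent[OF assms(1,2)] 1 2
    using b_near_diag[of m n] diag(2)[of "Suc n" m] diag(2)[of "Suc n" "Suc m"] assms False
    by simp
qed

text \<open>The step lemmas mirror the recurrence of \<open>e\<close>; rows of \<open>a\<close> are
  reached from the zero last row upwards, rows of \<open>b\<close> from the zero first row
  downwards.\<close>

lemma row_sums:
  assumes "n \<ge> 2"
  shows "1 \<le> m \<Longrightarrow> m \<le> n \<Longrightarrow> row_sum a n m = e n m \<and> row_sum b n m = e n (n + 1 - m)"
  using assms
proof (induction n arbitrary: m rule: nat_induct_at_least)
  case base
  have "e 2 2 = 0" "e 2 1 = 1" using e_diag[of 2] e_step[of 0 0] e_1_1 by (simp_all add: numeral_2_eq_2)
  moreover have "m = 1 \<or> m = 2" using base by auto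
  moreover have "{1..2::nat} = {1, 2}" by auto
  ultimately show ?case using base_entries by (auto simp: row_sum_def)
next
  case (Suc n)
  note rows = Suc.IH
  have A: "1 \<le> m \<longrightarrow> row_sum a (Suc n) m = e (Suc n) m" if "m \<le> Suc n" for m
    using that
  proof (induction m rule: inc_induct)
    case base
    have "row_sum a (Suc n) (Suc n) = 0"
      unfolding row_sum_def using boundary(3)[of "Suc n"] Suc.hyps by (intro sum.neutral) auto
    then show ?case using e_diag[of "Suc n"] Suc.hyps by simp
  next
    case (step m)
    then show ?case
      using row_sum_a_step[of m n] Suc.IH[of m] Suc.hyps e_rec[of m "Suc n"] by auto
  qed
  have B: "m \<le> Suc n \<longrightarrow> row_sum b (Suc n) m = e (Suc n) (Suc n + 1 - m)" if "1 \<le> m" for m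
    using that
  proof (induction m rule: nat_induct_at_least)
    case base
    have "row_sum b (Suc n) 1 = 0"
      unfolding row_sum_def using boundary(4)[of "Suc n"] Suc.hyps by (intro sum.neutral) auto
    then show ?case using e_diag[of "Suc n"] Suc.hyps by simp
  next
    case (Suc m)
    then show ?case
      using row_sum_b_step[of m n] Suc.IH Suc.hyps e_rec[of "Suc n - m" "Suc n"] \<open>n \<ge> 2\<close>
        rows[of m]
      by (auto simp: Suc_diff_le)
  qed
  show ?case using A B Suc.prems by blast
qed

section \<open>Column sums\<close>

lemma lower_entries:
  assumes col: "\<And>r k. 2 \<le> r \<Longrightarrow> r < N \<Longrightarrow> 1 \<le> k \<Longrightarrow> k < r \<Longrightarrow> col_sum a r k = e r (r - k)"
    and "i + j + l + 3 \<le> N"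
  shows "a (i + j + l + 3) (i + j + 2) (i + 1) = lowX i j l \<and>
    b (i + j + l + 3) (i + j + 2) (i + 1) = lowY i j l"
  using assms(2)
proof (induction l arbitrary: i j)
  \<comment> \<open>\<open>l = 0\<close> is the row above the last. Its entries come from column
    sums of \<open>a\<close> at smaller sizes, hence from \<open>col\<close>, except in the first
    column of \<open>a\<close>.\<close>
  case 0
  let ?n = "i + j + 2"
  have "a (Suc ?n) ?n (i + 1) = b ?n ?n (i + 1)"
    using a_step_lower[of "i + 1" ?n ?n] boundary(3)[of "Suc ?n" "i + 1"] by simp
  also have "\<dots> = e (i + j + 1) (j + 1)"
  proof (cases "i = 0")
    \<comment> \<open>In the first column the corner of \<open>b\<close> takes over: 0 from size 3
      on, and \<open>b 2 2 1 = 1 = e 1 1\<close> at size 2.\<close>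
    case True
    then show ?thesis
      using b_corner[of ?n] base_entries e_1_1 e_diag[of "j + 1"] by (cases "j = 0") (auto simp: numeral_2_eq_2)
  next
    case False
    then show ?thesis using b_last_row[of i "i + j + 1"] col[of "i + j + 1" i] 0 by simp
  qed
  finally have A: "a (Suc ?n) ?n (i + 1) = e (i + j + 1) (j + 1)" .
  have B: "b (Suc ?n) ?n (i + 1) = e (i + j + 2) (j + 1)"
    using b_penultimate_row[of "i + 1" ?n] col[of ?n "i + 1"] 0 by simp
  have "i + j + 0 + 3 = Suc ?n" by simp
  then show ?case using A B by (simp only: low_simps)
next
  case (Suc l)
  have "i + j + Suc l + 3 = Suc (i + j + l + 3)" "Suc (i + j + 2) = i + Suc j + 2"
    "i + j + l + 4 = i + Suc j + l + 3" by simp_all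
  then show ?case
    using a_step_lower[of "i + 1" "i + j + 2" "i + j + l + 3"]
      b_step_lower[of "i + 1" "i + j + 2" "i + j + l + 3"] Suc.IH[of i j] Suc.IH[of i "Suc j"] Suc.prems
    by (simp add: low_simps)
qed

lemma upper_entries:
  assumes col: "\<And>r k. 2 \<le> r \<Longrightarrow> r < N \<Longrightarrow> 1 \<le> k \<Longrightarrow> k < r \<Longrightarrow> col_sum b r k = e r (r - k)"
    and "i + j + l + 3 \<le> N"
  shows "a (i + j + l + 3) (l + 1) (l + j + 2) = uppX i j l \<and>
    b (i + j + l + 3) (l + 1) (l + j + 2) = - uppY i j l"
  using assms(2)
proof (induction l arbitrary: i j)
  case 0
  have "i + j + 0 + 3 = Suc (i + j + 2)" by simp
  then show ?case
    using a_first_row[of "j + 1" "i + j + 2"] col[of "i + j + 2" "j + 1"] 0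
      boundary(4)[of "i + j + 3" "j + 2"] by (simp add: upp_simps numeral_3_eq_3)
next
  case (Suc l)
  then show ?case
    using a_step_upper[of "l + 1" "l + j + 2" "i + j + l + 3"]
      b_step_upper[of "l + 1" "l + j + 2" "i + j + l + 3"] Suc.IH[of i j] Suc.IH[of i "Suc j"]
    by (simp add: upp_simps)
qed

text \<open>Reflection in the antidiagonal exchanges the coordinates \<open>i\<close> and
  \<open>l\<close>.\<close>

lemma a_antitranspose:
  assumes "\<And>r k. 2 \<le> r \<Longrightarrow> r < n \<Longrightarrow> 1 \<le> k \<Longrightarrow> k < r \<Longrightarrow> col_sum a r k = e r (r - k)"
    and "\<And>r k. 2 \<le> r \<Longrightarrow> r < n \<Longrightarrow> 1 \<le> k \<Longrightarrow> k < r \<Longrightarrow> col_sum b r k = e r (r - k)"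
    and "n \<ge> 3" "1 \<le> m" "m < n" "1 \<le> k" "k < n"
  shows "a n (n - k) (n - m) = a n m k"
proof (cases m k rule: linorder_cases)
  case equal
  then show ?thesis using assms diag(1)[of n m] diag(1)[of n "n - m"] by simp
next
  case greater
  define i j l where "i = k - 1" "j = m - k - 1" "l = n - 1 - m"
  then have eqs: "i + j + l + 3 = n" "i + j + 2 = m" "i + 1 = k"
    "l + j + i + 3 = n" "l + j + 2 = n - k" "l + 1 = n - m" using assms greater by auto
  have "a n m k = lowX i j l"
    using lower_entries[of n i j l, unfolded eqs] assms(1) by blast
  moreover have "a n (n - k) (n - m) = lowX l j i"
    using lower_entries[of n l j i, unfolded eqs] assms(1) by blast
  ultimately show ?thesis using lowX_symmetric[of i j l] by simp
next
  case less
  define i j l where "i = n - 1 - k" "j = k - m - 1" "l = m - 1"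
  then have eqs: "i + j + l + 3 = n" "l + 1 = m" "l + j + 2 = k"
    "l + j + i + 3 = n" "i + j + 2 = n - m" "i + 1 = n - k" using assms less by auto
  have "a n m k = uppX i j l"
    using upper_entries[of n i j l, unfolded eqs] assms(2) by blast
  moreover have "a n (n - k) (n - m) = uppX l j i"
    using upper_entries[of n l j i, unfolded eqs] assms(2) by blast
  ultimately show ?thesis using uppX_symmetric[of i j l] by simp
qed

lemma col_sum_a_step:
  assumes "\<And>r k. 2 \<le> r \<Longrightarrow> r < n \<Longrightarrow> 1 \<le> k \<Longrightarrow> k < r \<Longrightarrow> col_sum a r k = e r (r - k)"
    and "\<And>r k. 2 \<le> r \<Longrightarrow> r < n \<Longrightarrow> 1 \<le> k \<Longrightarrow> k < r \<Longrightarrow> col_sum b r k = e r (r - k)"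
    and n: "n \<ge> 3" and k: "1 \<le> k" "k < n"
  shows "col_sum a n k = e n (n - k)"
proof -
  \<comment> \<open>The last row and column vanish, and the remaining range is stable under
    \<open>m\<close> to \<open>n - m\<close>.\<close>
  have s: "{1..n} = insert n {1..<n}" using n by auto
  have "col_sum a n k = (\<Sum>m=1..<n. a n m k)"
    unfolding col_sum_def s using boundary(3)[of n k] n k by simp
  also have "\<dots> = (\<Sum>m=1..<n. a n (n - k) (n - m))"
    using a_antitranspose[OF assms(1,2) n] k by (intro sum.cong) auto
  also have "\<dots> = (\<Sum>m=1..<n. a n (n - k) m)"
    by (rule sum.reindex_bij_witness[of _ "\<lambda>m. n - m" "\<lambda>m. n - m"]) auto
  also have "\<dots> = row_sum a n (n - k)"
    unfolding row_sum_def s using boundary(1)[of n "n - k"] n k by simp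
  also have "\<dots> = e n (n - k)" using row_sums[of n "n - k"] n k by simp
  finally show ?thesis .
qed

text \<open>A column is split at the diagonal. \<open>cola\<close> must include size
  \<open>n\<close>, because the part below is read off as an entry of
  \<open>a (Suc n)\<close>.\<close>

lemma col_sum_b_step:
  assumes cola: "\<And>r k. 2 \<le> r \<Longrightarrow> r \<le> n \<Longrightarrow> 1 \<le> k \<Longrightarrow> k < r \<Longrightarrow> col_sum a r k = e r (r - k)"
    and colb: "\<And>r k. 2 \<le> r \<Longrightarrow> r < n \<Longrightarrow> 1 \<le> k \<Longrightarrow> k < r \<Longrightarrow> col_sum b r k = e r (r - k)"
    and n: "n \<ge> 3" and k: "1 \<le> k" "k < n"
  shows "col_sum b n k = e n (n - k)"
proof -
  have near: "lowY p 0 q + uppY q 0 p = a (n - 1) (p + 1) (p + 1)" if "p + q + 3 = n" for p q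
  proof -
    have eqs: "p + 0 + q + 3 = n" "q + 0 + p + 3 = n" using that by auto
    have "col_sum a r k = e r (r - k)" if "2 \<le> r" "r < n" "1 \<le> k" "k < r" for r k
      using cola that by simp
    then have "b n (p + 2) (p + 1) = lowY p 0 q"
      using lower_entries[of n p 0 q, unfolded eqs] by simp
    moreover have "b n (p + 1) (p + 2) = - uppY q 0 p"
      using upper_entries[of n q 0 p, unfolded eqs] colb by simp
    moreover have "b n (p + 2) (p + 1) = b n (p + 1) (p + 2) + a (n - 1) (p + 1) (p + 1)"
      using b_near_diag[of "p + 1" "n - 1"] that by auto
    ultimately show ?thesis by simp
  qed
  \<comment> \<open>For \<open>n = 3\<close> this forces \<open>p = q = 0\<close>; otherwise both
    sides vanish.\<close>
  have a_diag: "a (n - 1) (p + 1) (p + 1) = a (n - 1) (q + 1) (q + 1)" if "p + q + 3 = n" for p q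
  proof (cases "n = 3")
    case False
    then show ?thesis using that n diag(1)[of "n - 1" "p + 1"] diag(1)[of "n - 1" "q + 1"] by simp
  qed (use that in simp)
  \<comment> \<open>By \<open>near\<close> and \<open>a_diag\<close> the two arrays have equal
    differences along the antidiagonal, so equality spreads from \<open>i = 0\<close>.\<close>
  have XX: "i + l + 2 = n \<Longrightarrow> lowX i 0 l = uppX i 0 l" for i l
  proof (induction i arbitrary: l)
    case 0
    then show ?case by (simp add: lowX_eq_uppX_0)
  next
    case (Suc i)
    then show ?case
      using lowX_antidiagonal[of i l] uppX_antidiagonal[of i l] near[of i l] near[of l i] a_diag[of i l]
        Suc.IH[of "Suc l"] by simp
  qed
  define i l where il: "i = k - 1" "l = n - 1 - k"
  then have nk: "n = i + l + 2" "k = i + 1" "n - k = l + 1" using k by auto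
  have "(\<Sum>m=Suc k..n. b n m k) = a (Suc n) (Suc k) k"
    using a_lower[of k "Suc k" n] n k by simp
  also have "\<dots> = lowX i 0 l"
    using lower_entries[of "Suc n" i 0 l] cola nk by (simp add: numeral_3_eq_3)
  finally have low: "(\<Sum>m=Suc k..n. b n m k) = lowX i 0 l" .
  have "b n (r + 1) k = - uppY l (i - Suc r) r" if "r < i" for r
  proof -
    have "l + (i - Suc r) + r + 3 = n" "r + (i - Suc r) + 2 = k" using nk that by auto
    then show ?thesis using upper_entries[of n l "i - Suc r" r] colb by auto
  qed
  then have "(\<Sum>r<i. b n (Suc r) k) = (\<Sum>r<i. - uppY l (i - Suc r) r)"
    by (intro sum.cong) simp_all
  moreover have "(\<Sum>m=1..<k. b n m k) = (\<Sum>r<i. b n (Suc r) k)"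
    using sum.shift_bounds_Suc_ivl[of "\<lambda>m. b n m k" 0 i] nk(2) by (simp add: lessThan_atLeast0)
  ultimately have "(\<Sum>m=1..<k. b n m k) = (\<Sum>r<i. - uppY l (i - Suc r) r)" by simp
  \<comment> \<open>Unrolling turns the part above the diagonal into the desired value minus
    \<open>uppX l 0 i\<close>, which cancels the part below.\<close>
  then have upp: "(\<Sum>m=1..<k. b n m k) = e n (n - k) - uppX l 0 i"
    using uppX_unroll[of l i] nk by (simp add: sum_negf add_ac)
  show ?thesis
    unfolding col_sum_def sum_split_adjacent(2)[OF k(1) less_imp_le[OF k(2)]] low upp
    using diag(2)[of n k] n k XX[of i l] uppX_symmetric[of i 0 l] nk by simp
qed

lemma col_sums:
  assumes "n \<ge> 2" "1 \<le> k" "k < n"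
  shows "col_sum a n k = e n (n - k) \<and> col_sum b n k = e n (n - k)"
  using assms
proof (induction n arbitrary: k rule: less_induct)
  case (less n)
  show ?case
  proof (cases "n = 2")
    case True
    have "e 2 1 = 1" using e_diag[of 2] e_step[of 0 0] e_1_1 by (simp add: numeral_2_eq_2)
    moreover have "{1..2::nat} = {1, 2}" "k = 1" using True less.prems by auto
    ultimately show ?thesis using True base_entries by (auto simp: col_sum_def)
  next
    case False
    then have n: "n \<ge> 3" using less.prems by simp
    have IH: "col_sum a r k = e r (r - k)" "col_sum b r k = e r (r - k)"
      if "2 \<le> r" "r < n" "1 \<le> k" "k < r" for r k
      using less.IH[of r k] that by simp_all
    have A: "col_sum a n k = e n (n - k)" if "1 \<le> k" "k < n" for k
      by (rule col_sum_a_step) (use that in \<open>simp_all add: IH n\<close>)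
    have IH': "col_sum a r k = e r (r - k)" if "2 \<le> r" "r \<le> n" "1 \<le> k" "k < r" for r k
      using A[of k] IH(1)[of r k] that by (cases "r = n") auto
    have "col_sum b n k = e n (n - k)"
      by (rule col_sum_b_step) (use less.prems in \<open>simp_all add: IH IH' n\<close>)
    then show ?thesis using A less.prems by simp
  qed
qed

text \<open>Treated apart because \<open>entringer_array\<close> fixes no value
  \<open>e n 0\<close>.\<close>

lemma col_sums_last:
  assumes "n \<ge> 2"
  shows "col_sum a n n = 0" "col_sum b n n = 0"
  unfolding col_sum_def using boundary(1,2)[of n] assms by (auto intro!: sum.neutral)

end

theorem theorem9p1:
  fixes e :: "nat \<Rightarrow> nat \<Rightarrow> int"
  assumes "entringer_array e"
  shows "(\<forall>n\<ge>1. of_int (\<Sum>k=1..2*n-1. e (2*n-1) k) = tan_sec_number (2*n-1) \<and>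
                of_int (\<Sum>k=1..2*n. e (2*n) k) = tan_sec_number (2*n)) \<and>
         (\<forall>a b. twin_seidel a b \<longrightarrow>
            (\<forall>n\<ge>2.
               (\<forall>m\<in>{1..n}. row_sum a n m = e n m \<and> row_sum b n m = e n (n + 1 - m)) \<and>
               (\<forall>k\<in>{1..n}. col_sum a n k = (if k = n then 0 else e n (n - k)) \<and>
                           col_sum b n k = (if k = n then 0 else e n (n - k)))))"
proof (intro conjI allI impI)
  interpret entringer e by unfold_locales (rule assms)
  fix n :: nat
  assume "n \<ge> 1"
  then show "of_int (\<Sum>k=1..2*n-1. e (2*n-1) k) = tan_sec_number (2*n-1)"
    and "of_int (\<Sum>k=1..2*n. e (2*n) k) = tan_sec_number (2*n)"
    by (simp_all only: sum_e_eq_tan_sec_number)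
next
  fix a b n
  assume "twin_seidel a b" and n: "(2::nat) \<le> n"
  then interpret twin_entringer e a b
    using assms by unfold_locales
  show "\<forall>m\<in>{1..n}. row_sum a n m = e n m \<and> row_sum b n m = e n (n + 1 - m)"
    using row_sums[OF n] by simp
  show "\<forall>k\<in>{1..n}. col_sum a n k = (if k = n then 0 else e n (n - k)) \<and>
      col_sum b n k = (if k = n then 0 else e n (n - k))"
    using col_sums[OF n] col_sums_last[OF n] by auto
qed

end
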